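(* For every integer $m\ge 0$ and every integer $k\ge 2$, the series below converges and $$\frac{1}{\pi}=\frac{(1/2)_{m+k}}{2^{2m}}\,\frac{(2m)!}{m!}\,\sum_{n=0}^\infty \frac{(m+1/2)_n\,\langle m-1/2\rangle_n\,(m+1/2)_{k+n}\,(k+m+2n+1/2)}{n!\,(k+n)!\,(2m+k+n)!}.$$
   Context: For a number $x$ and a non-negative integer $n$, the rising factorial is $(x)_0=1$, $(x)_n=x(x+1)(x+2)\cdots(x+n-1)$ for $n\ge 1$, and the falling factorial is $\langle x\rangle_0=1$, $\langle x\rangle_n=x(x-1)(x-2)\cdots(x-n+1)$ for $n\ge 1$. In the summand, $(k+m+2n+1/2)$ is an ordinary factor (not a rising factorial). *)

theory Defs
  imports "HOL-Analysis.Analysis"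
begin

(* The rising factorial is the library's pochhammer. *)

definition falling_factorial :: "real \<Rightarrow> nat \<Rightarrow> real" where
  "falling_factorial x n = (\<Prod>i<n. x - real i)"

definition inv_pi_summand :: "nat \<Rightarrow> nat \<Rightarrow> nat \<Rightarrow> real" where
  "inv_pi_summand m k n =
     pochhammer (real m + 1/2) n * falling_factorial (real m - 1/2) n
       * pochhammer (real m + 1/2) (k + n) * (real k + real m + 2 * real n + 1/2)
     / (fact n * fact (k + n) * fact (2 * m + k + n))"

end

(* With a = k + m + 1/2, b = m + 1/2 and c = 1/2 - m, the series is a multiple of the
   very-well-poised hypergeometric series 4F3(a, 1 + a/2, b, c; a/2, 1 + a - b, 1 + a - c; -1).
   Its value is Gamma(1+a-b) Gamma(1+a-c) / (Gamma(1+a) Gamma(1+a-b-c)): the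
   Wilf-Zeilberger certificate n / (a + 2n) shows that the quotient of the two sides is
   invariant under a -> a + 1, and both sides tend to 1 as a grows by integer steps. *)

theory Submission
  imports Defs "HOL-Real_Asymp.Real_Asymp"
begin

section \<open>Growth of Pochhammer symbols\<close>

text \<open>This is Gauss's limit for 1/Gamma, the library's \<open>rGamma_series\<close>, with its
  exponential written as a \<open>powr\<close>. The two forms may differ at n = 0, hence the passage
  through \<open>eventually\<close>. Both the convergence estimates and the final Gamma quotient
  rest on it.\<close>

lemma pochhammer_over_fact_powr_LIMSEQ:
  fixes z :: real
  shows "(\<lambda>n. pochhammer z (Suc n) / (fact n * real n powr z)) \<longlonglongrightarrow> rGamma z"
proof -
  have "eventually (\<lambda>n. rGamma_series z n = pochhammer z (Suc n) / (fact n * real n powr z)) sequentially"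
    using eventually_gt_at_top[of 0]
    by eventually_elim (simp add: rGamma_series_def powr_def)
  then show ?thesis
    using rGamma_series_LIMSEQ[of z] by (rule Lim_transform_eventually[rotated])
qed

lemma pochhammer_Suc_bigo:
  fixes z :: real
  shows "(\<lambda>n. pochhammer z (Suc n)) \<in> O(\<lambda>n. fact n * real n powr z)"
proof (rule bigoI_tendsto[OF pochhammer_over_fact_powr_LIMSEQ])
  show "eventually (\<lambda>n. fact n * real n powr z \<noteq> 0) sequentially"
    using eventually_gt_at_top[of 0] by eventually_elim simp
qed

text \<open>For positive z the limit \<open>rGamma z\<close> is nonzero, so the limit can be
  inverted.\<close>

lemma inverse_pochhammer_Suc_bigo:
  fixes z :: real
  assumes "z > 0"
  shows "(\<lambda>n. 1 / pochhammer z (Suc n)) \<in> O(\<lambda>n. 1 / (fact n * real n powr z))"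
proof (rule bigoI_tendsto)
  have "rGamma z \<noteq> 0"
    using assms by (auto simp: rGamma_eq_zero_iff elim!: nonpos_Ints_cases)
  then have "(\<lambda>n. inverse (pochhammer z (Suc n) / (fact n * real n powr z))) \<longlonglongrightarrow> inverse (rGamma z)"
    by (intro tendsto_inverse pochhammer_over_fact_powr_LIMSEQ)
  then show "(\<lambda>n. 1 / pochhammer z (Suc n) / (1 / (fact n * real n powr z))) \<longlonglongrightarrow> inverse (rGamma z)"
    by (simp add: field_simps del: pochhammer_Suc)
  show "eventually (\<lambda>n. 1 / (fact n * real n powr z) \<noteq> 0) sequentially"
    using eventually_gt_at_top[of 0] by eventually_elim simp
qed

lemma inverse_fact_Suc_bigo:
  "(\<lambda>n. 1 / fact (Suc n) :: real) \<in> O(\<lambda>n. 1 / (fact n * real n powr 1))"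
  using inverse_pochhammer_Suc_bigo[of 1] by (simp only: pochhammer_fact[symmetric])

lemma affine_bigo:
  "(\<lambda>n. p + q * real (Suc n)) \<in> O(\<lambda>n. real n powr 1)"
proof -
  have "(\<lambda>n. p + q * real (Suc n)) \<in> O(\<lambda>n. real n)"
    by real_asymp
  then show ?thesis by simp
qed

section \<open>The very-well-poised series and its convergence\<close>

text \<open>The factor (a + 2n)/a is the very-well-poised quotient (1 + a/2)_n / (a/2)_n in closed
  form. The term at n = 0 is normalised to 1.\<close>

definition well_poised_summand :: "real \<Rightarrow> real \<Rightarrow> real \<Rightarrow> nat \<Rightarrow> real" where
  "well_poised_summand a b c n =
     (-1) ^ n * ((a + 2 * real n) / a)
       * (pochhammer a n * pochhammer b n * pochhammer c n)
     / (fact n * pochhammer (1 + a - b) n * pochhammer (1 + a - c) n)"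

text \<open>Three factorials above cancel three below, and the powers of n add up: 1 + a + b + c
  from the numerator, minus 1, 1 + a - b and 1 + a - c from the denominator.\<close>

lemma well_poised_summand_bigo:
  assumes "a > 0" "1 + a - b > 0" "1 + a - c > 0"
  shows "(\<lambda>n. well_poised_summand a b c (Suc n)) \<in> O(\<lambda>n. real n powr (2 * b + 2 * c - a - 2))"
proof -
  have 1: "(\<lambda>n. (-1) ^ Suc n :: real) \<in> O(\<lambda>n. 1)"
    by (intro bigoI[of _ 1]) simp
  have 2: "(\<lambda>n. (a + 2 * real (Suc n)) / a) \<in> O(\<lambda>n. real n powr 1)"
    using affine_bigo[of 1 "2 / a"] assms by (simp add: field_simps)
  have "(\<lambda>n. well_poised_summand a b c (Suc n)) \<in>
      O(\<lambda>n. 1 * real n powr 1 * ((fact n * real n powr a) * (fact n * real n powr b) * (fact n * real n powr c))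
       * (1 / (fact n * real n powr 1) * (1 / (fact n * real n powr (1 + a - b)))
           * (1 / (fact n * real n powr (1 + a - c)))))"
    (is "_ \<in> O(?g)")
  proof -
    have eq: "well_poised_summand a b c (Suc n) = (-1) ^ Suc n * ((a + 2 * real (Suc n)) / a)
        * (pochhammer a (Suc n) * pochhammer b (Suc n) * pochhammer c (Suc n))
        * (1 / fact (Suc n) * (1 / pochhammer (1 + a - b) (Suc n)) * (1 / pochhammer (1 + a - c) (Suc n)))" for n
      by (simp add: well_poised_summand_def del: pochhammer_Suc)
    show ?thesis
      unfolding eq
      by (intro landau_o.big.mult 1 2 pochhammer_Suc_bigo inverse_pochhammer_Suc_bigo
         inverse_fact_Suc_bigo assms)
  qed
  also have "?g \<in> \<Theta>(\<lambda>n. real n powr (2 * b + 2 * c - a - 2))"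
  proof (rule bigthetaI_cong)
    show "eventually (\<lambda>n. ?g n = real n powr (2 * b + 2 * c - a - 2)) sequentially"
      using eventually_gt_at_top[of 0]
    proof eventually_elim
      case (elim n)
      have "2 * b + 2 * c - a - 2 = a + b + c - (1 + a - b) - (1 + a - c)" by simp
      then have "real n powr (2 * b + 2 * c - a - 2)
        = real n powr a * real n powr b * real n powr c / real n powr (1 + a - b) / real n powr (1 + a - c)"
        using elim by (simp only: powr_add powr_diff)
      then show ?case using elim by simp
    qed
  qed
  finally show ?thesis .
qed

text \<open>The last hypothesis says exactly that the exponent 2b + 2c - a - 2 lies below -1, so the
  comparison series converges.\<close>

lemma summable_well_poised:
  assumes "a > 0" "1 + a - b > 0" "1 + a - c > 0" "2 * (b + c) < a + 1"
  shows "summable (well_poised_summand a b c)"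
proof -
  have "summable (\<lambda>n. well_poised_summand a b c (Suc n))"
    by (rule summable_comparison_test_bigo[OF _ well_poised_summand_bigo])
       (use assms in \<open>simp_all add: summable_real_powr_iff\<close>)
  then show ?thesis by (simp only: summable_Suc_iff)
qed

text \<open>The certificate n / (a + 2n) is bounded by 1, so its product with the summand inherits
  the limit 0. This is the boundary term at infinity when telescoping.\<close>

lemma well_poised_certificate_tendsto_0:
  assumes "a > 0" "1 + a - b > 0" "1 + a - c > 0" "2 * (b + c) < a + 1"
  shows "(\<lambda>n. real n * well_poised_summand a b c n / (a + 2 * real n)) \<longlonglongrightarrow> 0"
proof (rule tendsto_0_le[where K = 1])
  show "well_poised_summand a b c \<longlonglongrightarrow> 0"
    using summable_well_poised[OF assms] by (rule summable_LIMSEQ_zero)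
  show "eventually (\<lambda>n. norm (real n * well_poised_summand a b c n / (a + 2 * real n))
      \<le> norm (well_poised_summand a b c n) * 1) sequentially"
  proof (intro always_eventually allI)
    fix n
    have "real n / (a + 2 * real n) \<le> 1" using assms by simp
    then have "real n / (a + 2 * real n) * \<bar>well_poised_summand a b c n\<bar> \<le> 1 * \<bar>well_poised_summand a b c n\<bar>"
      by (rule mult_right_mono) simp
    then show "norm (real n * well_poised_summand a b c n / (a + 2 * real n))
      \<le> norm (well_poised_summand a b c n) * 1"
      using assms by (simp add: abs_mult)
  qed
qed

section \<open>The shift from a to a + 1\<close>

lemma pochhammer_plus1:
  fixes x :: real
  assumes "x > 0"
  shows "pochhammer (x + 1) n = pochhammer x n * (x + real n) / x"
  using pochhammer_rec[of x n] pochhammer_rec'[of x n] assms by (simp add: field_simps)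

text \<open>This is the Wilf-Zeilberger equation. Each of the four terms is a rational function of n
  times one common hypergeometric factor, so everything reduces to a polynomial identity.\<close>

lemma well_poised_telescoping:
  assumes "a > 0" "1 + a - b > 0" "1 + a - c > 0"
  shows "well_poised_summand (a + 1) b c n * ((1 + a) * (1 + a - b - c) / ((1 + a - b) * (1 + a - c)))
      - well_poised_summand a b c n
    = real (Suc n) * well_poised_summand a b c (Suc n) / (a + 2 * real (Suc n))
      - real n * well_poised_summand a b c n / (a + 2 * real n)"
proof -
  define N where "N = real n"
  define X where "X = 1 + a - b"
  define Y where "Y = 1 + a - c"
  have pos: "a > 0" "X > 0" "Y > 0" "N \<ge> 0" and b: "b = 1 + a - X" and c: "c = 1 + a - Y"
    using assms by (simp_all add: N_def X_def Y_def)
  have nz: "X + N \<noteq> 0" "Y + N \<noteq> 0" "a + 2 * N \<noteq> 0" "N + 1 \<noteq> 0" "a + 2 * (N + 1) \<noteq> 0"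
    "1 + a \<noteq> 0" "pochhammer X n \<noteq> 0" "pochhammer Y n \<noteq> 0"
    using pos pochhammer_pos[of X n] pochhammer_pos[of Y n] by auto
  \<comment> \<open>\<open>T\<close> is the common factor: the summand stripped of a + 2N, which is
    also what the denominator of the certificate cancels.\<close>
  define T where "T = (-1) ^ n * (pochhammer a n * pochhammer b n * pochhammer c n)
     / (a * fact n * pochhammer X n * pochhammer Y n)"
  have t: "well_poised_summand a b c n = (a + 2 * N) * T"
    by (simp add: well_poised_summand_def T_def X_def Y_def N_def mult_ac)
  have t_a: "well_poised_summand (a + 1) b c n =
      (a + 1 + 2 * N) * (a + N) * X * Y / ((a + 1) * (X + N) * (Y + N)) * T"
  proof -
    have *: "1 + (a + 1) - b = X + 1" "1 + (a + 1) - c = Y + 1" by (simp_all add: X_def Y_def)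
    show ?thesis
      unfolding well_poised_summand_def * pochhammer_plus1[OF pos(1)]
        pochhammer_plus1[OF pos(2)] pochhammer_plus1[OF pos(3)] T_def N_def[symmetric]
      using nz pos by (simp add: divide_simps)
  qed
  have t_n: "well_poised_summand a b c (Suc n) =
      - (a + 2 * (N + 1)) * (a + N) * (b + N) * (c + N) / ((N + 1) * (X + N) * (Y + N)) * T"
    unfolding well_poised_summand_def X_def[symmetric] Y_def[symmetric] T_def pochhammer_Suc
      fact_Suc of_nat_Suc power_Suc N_def[symmetric]
    using nz pos by (simp add: divide_simps add_ac) (simp add: algebra_simps)
  have Suc: "real (Suc n) = N + 1" by (simp add: N_def)
  \<comment> \<open>The polynomial core, obtained by dividing by \<open>T\<close> and clearing (X +
    N)(Y + N). With b and c expressed through X and Y it is checked by expansion.\<close>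
  have "(a + 1 + 2 * N) * (a + N) * (1 + a - b - c) - (a + 2 * N) * ((X + N) * (Y + N))
      = - ((a + N) * (b + N) * (c + N)) - N * ((X + N) * (Y + N))"
    unfolding b c by (simp add: algebra_simps)
  then have "((a + 1 + 2 * N) * (a + N) * (1 + a - b - c) - (a + 2 * N) * ((X + N) * (Y + N)))
        / ((X + N) * (Y + N)) * T
      = (- ((a + N) * (b + N) * (c + N)) - N * ((X + N) * (Y + N))) / ((X + N) * (Y + N)) * T"
    by simp
  then have "(a + 1 + 2 * N) * (a + N) * (1 + a - b - c) / ((X + N) * (Y + N)) * T - (a + 2 * N) * T
      = - ((a + N) * (b + N) * (c + N)) / ((X + N) * (Y + N)) * T - N * T"
    using nz by (simp add: diff_divide_distrib left_diff_distrib)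
  moreover have "well_poised_summand (a + 1) b c n * ((1 + a) * (1 + a - b - c) / (X * Y))
      = (a + 1 + 2 * N) * (a + N) * (1 + a - b - c) / ((X + N) * (Y + N)) * T"
    unfolding t_a using nz pos by (simp add: divide_simps add_ac)
  moreover have "(N + 1) * well_poised_summand a b c (Suc n) / (a + 2 * (N + 1))
      = - ((a + N) * (b + N) * (c + N)) / ((X + N) * (Y + N)) * T"
    unfolding t_n using nz pos by (simp add: divide_simps) (simp add: algebra_simps)
  moreover have "N * well_poised_summand a b c n / (a + 2 * N) = N * T"
    unfolding t using nz by simp
  ultimately show ?thesis
    unfolding Suc N_def[symmetric] X_def[symmetric] Y_def[symmetric] t by simp
qed

text \<open>Summing the telescoping identity over all n leaves only boundary terms. The one at n = 0
  vanishes through its factor n, the one at infinity by the certificate limit.\<close>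

lemma suminf_well_poised_plus1:
  assumes "a > 0" "1 + a - b > 0" "1 + a - c > 0" "2 * (b + c) < a + 1"
  shows "suminf (well_poised_summand a b c) =
    (1 + a) * (1 + a - b - c) / ((1 + a - b) * (1 + a - c)) * suminf (well_poised_summand (a + 1) b c)"
proof -
  let ?r = "(1 + a) * (1 + a - b - c) / ((1 + a - b) * (1 + a - c))"
  have s: "summable (well_poised_summand a b c)" "summable (well_poised_summand (a + 1) b c)"
    using assms by (intro summable_well_poised; simp)+
  have "(\<lambda>n. well_poised_summand (a + 1) b c n * ?r - well_poised_summand a b c n) sums
      (0 - real 0 * well_poised_summand a b c 0 / (a + 2 * real 0))"
    unfolding well_poised_telescoping[OF assms(1-3)]
    by (rule telescope_sums[OF well_poised_certificate_tendsto_0[OF assms]])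
  moreover have "(\<lambda>n. well_poised_summand (a + 1) b c n * ?r - well_poised_summand a b c n) sums
      (suminf (well_poised_summand (a + 1) b c) * ?r - suminf (well_poised_summand a b c))"
    by (intro sums_diff sums_mult2 summable_sums s)
  ultimately have "suminf (well_poised_summand (a + 1) b c) * ?r - suminf (well_poised_summand a b c) = 0"
    by (auto dest: sums_unique2)
  then show ?thesis by (simp add: mult.commute)
qed

lemma suminf_well_poised_plus_nat:
  assumes "a > 0" "1 + a - b > 0" "1 + a - c > 0" "2 * (b + c) < a + 1"
  shows "suminf (well_poised_summand a b c) =
    pochhammer (1 + a) j * pochhammer (1 + a - b - c) j / (pochhammer (1 + a - b) j * pochhammer (1 + a - c) j)
      * suminf (well_poised_summand (a + real j) b c)"
proof (induction j)
  case (Suc j)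
  have eq: "suminf (well_poised_summand (a + real j) b c) =
    (1 + a + real j) * (1 + a - b - c + real j) / ((1 + a - b + real j) * (1 + a - c + real j))
      * suminf (well_poised_summand (a + real (Suc j)) b c)"
    using suminf_well_poised_plus1[of "a + real j" b c] assms by (simp add: algebra_simps)
  show ?case
    unfolding Suc.IH eq by (simp add: pochhammer_Suc mult_ac)
qed simp

section \<open>The limit of the sum as a grows\<close>

text \<open>The first factors contribute exactly y / x, and the others are compared one by one.
  Keeping y / x is what later makes the tail of the series decay under the shift of a.\<close>

lemma pochhammer_ratio_ge:
  fixes x y :: real
  assumes "0 < x" "x \<le> y"
  shows "pochhammer y (Suc n) \<ge> y / x * pochhammer x (Suc n)"
proof -
  have "pochhammer (x + 1) n \<le> pochhammer (y + 1) n"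
    unfolding pochhammer_prod using assms by (intro prod_mono) auto
  then have "y * pochhammer (x + 1) n \<le> y * pochhammer (y + 1) n"
    using assms by (intro mult_left_mono) auto
  then show ?thesis
    using assms by (simp add: pochhammer_rec)
qed

lemma pochhammer_mono_real:
  fixes x y :: real
  assumes "0 < x" "x \<le> y"
  shows "pochhammer x n \<le> pochhammer y n"
  unfolding pochhammer_prod using assms by (intro prod_mono) auto

text \<open>The bound separates a prefactor that tends to 0 as a' grows from a quantity free of a'.
  The condition on c gives a' <= 1 + a' - c, so the quotient of the corresponding Pochhammer symbols
  is at most 1.\<close>

lemma abs_well_poised_summand_Suc_le:
  assumes "0 < a" "0 < 1 + a - b" "a \<le> a'" "c \<le> 1"
  shows "\<bar>well_poised_summand a' b c (Suc n)\<bar> \<le>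
    (1 + a - b) / (1 + a' - b) * ((1 + 2 / a * real (Suc n)) * \<bar>pochhammer b (Suc n) * pochhammer c (Suc n)\<bar>
      * (1 / fact (Suc n) * (1 / pochhammer (1 + a - b) (Suc n))))"
proof -
  let ?m = "Suc n"
  have 1: "(a' + 2 * real ?m) / a' \<le> 1 + 2 / a * real ?m"
  proof -
    have "2 / a' \<le> 2 / a" using assms by (intro divide_left_mono) auto
    then have "2 / a' * real ?m \<le> 2 / a * real ?m" by (rule mult_right_mono) simp
    then show ?thesis using assms by (simp add: add_divide_distrib)
  qed
  have 2: "pochhammer a' ?m / pochhammer (1 + a' - c) ?m \<le> 1"
    using assms pochhammer_mono_real[of a' "1 + a' - c" ?m] pochhammer_pos[of "1 + a' - c" ?m]
    by (simp add: divide_le_eq)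
  have 3: "1 / pochhammer (1 + a' - b) ?m \<le> (1 + a - b) / (1 + a' - b) * (1 / pochhammer (1 + a - b) ?m)"
  proof -
    have "1 / pochhammer (1 + a' - b) ?m \<le> 1 / ((1 + a' - b) / (1 + a - b) * pochhammer (1 + a - b) ?m)"
      using assms pochhammer_pos[of "1 + a - b" ?m]
      by (intro divide_left_mono pochhammer_ratio_ge mult_pos_pos pochhammer_pos divide_pos_pos) auto
    then show ?thesis by simp
  qed
  have "\<bar>well_poised_summand a' b c ?m\<bar> =
     (a' + 2 * real ?m) / a' * \<bar>pochhammer b ?m * pochhammer c ?m\<bar>
       * (pochhammer a' ?m / pochhammer (1 + a' - c) ?m) * (1 / fact ?m) * (1 / pochhammer (1 + a' - b) ?m)"
    using assms pochhammer_pos[of a' ?m] pochhammer_pos[of "1 + a' - b" ?m] pochhammer_pos[of "1 + a' - c" ?m]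
    unfolding well_poised_summand_def by (simp add: abs_mult power_abs mult_ac del: pochhammer_Suc)
  also have "\<dots> \<le> (1 + 2 / a * real ?m) * \<bar>pochhammer b ?m * pochhammer c ?m\<bar>
       * 1 * (1 / fact ?m) * ((1 + a - b) / (1 + a' - b) * (1 / pochhammer (1 + a - b) ?m))"
    using assms pochhammer_pos[of a' ?m] pochhammer_pos[of "1 + a' - b" ?m] pochhammer_pos[of "1 + a' - c" ?m]
    by (intro mult_mono 1 2 3 order_refl mult_nonneg_nonneg divide_nonneg_nonneg) (auto intro: less_imp_le)
  finally show ?thesis by (simp add: mult_ac)
qed

text \<open>The term at n = 0 is 1, and all later terms together are at most a constant times 1 / (1
  + A - b + j).\<close>

lemma suminf_well_poised_tendsto_1:
  assumes "a > 0" "1 + a - b > 0" "2 * (b + c) < a + 1" "c \<le> 1"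
  shows "(\<lambda>j. suminf (well_poised_summand (a + real j) b c)) \<longlonglongrightarrow> 1"
proof -
  \<comment> \<open>The majorant \<open>D\<close> drops the quotient of order n^(c - 1), so its
    exponent is 2b + c - A - 1 and its convergence requires A > 2b + c. An initial shift by
    \<open>J\<close> ensures this; \<open>LIMSEQ_offset\<close> removes the shift at the
    end.\<close>
  obtain J :: nat where J: "real J > \<bar>2 * b + c - a\<bar>"
    using reals_Archimedean2 by blast
  define A where "A = a + real J"
  define D where "D = (\<lambda>n. (1 + 2 / A * real (Suc n)) * \<bar>pochhammer b (Suc n) * pochhammer c (Suc n)\<bar>
      * (1 / fact (Suc n) * (1 / pochhammer (1 + A - b) (Suc n))))"
  have A: "A > 0" "1 + A - b > 0" "2 * b + c < A" "A \<ge> a"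
    using assms J by (auto simp: A_def)
  have "summable D"
  proof (rule summable_comparison_test_bigo)
    show "summable (\<lambda>n. norm (real n powr (2 * b + c - A - 1)))"
      using A by (simp add: summable_real_powr_iff)
    have "D \<in> O(\<lambda>n. real n powr 1 * \<bar>(fact n * real n powr b) * (fact n * real n powr c)\<bar>
       * (1 / (fact n * real n powr 1) * (1 / (fact n * real n powr (1 + A - b)))))"
      (is "_ \<in> O(?g)")
      unfolding D_def
      by (intro landau_o.big.mult affine_bigo landau_o.big.abs_in_iff[THEN iffD2]
          landau_o.big.abs[THEN equalityD2, THEN subsetD] pochhammer_Suc_bigo inverse_fact_Suc_bigo
          inverse_pochhammer_Suc_bigo A)
    also have "?g \<in> \<Theta>(\<lambda>n. real n powr (2 * b + c - A - 1))"
    proof (rule bigthetaI_cong)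
      show "eventually (\<lambda>n. ?g n = real n powr (2 * b + c - A - 1)) sequentially"
        using eventually_gt_at_top[of 0]
      proof eventually_elim
        case (elim n)
        have "2 * b + c - A - 1 = b + c - (1 + A - b)" by simp
        then have "real n powr (2 * b + c - A - 1) = real n powr b * real n powr c / real n powr (1 + A - b)"
          using elim by (simp only: powr_add powr_diff)
        then show ?case using elim by (simp add: abs_mult)
      qed
    qed
    finally show "D \<in> O(\<lambda>n. real n powr (2 * b + c - A - 1))" .
  qed
  have bound: "norm (suminf (well_poised_summand (A + real j) b c) - 1)
      \<le> (1 + A - b) * suminf D * (1 / (1 + A - b + real j))" for j
  proof -
    let ?w = "well_poised_summand (A + real j) b c"
    have s: "summable ?w"
      using assms A by (intro summable_well_poised) auto
    have "?w 0 = 1" using A by (simp add: well_poised_summand_def)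
    then have "suminf ?w - 1 = (\<Sum>n. ?w (Suc n))"
      using suminf_split_head[OF s] by simp
    moreover have "norm (\<Sum>n. ?w (Suc n)) \<le> (\<Sum>n. (1 + A - b) / (1 + (A + real j) - b) * D n)"
    proof (rule norm_suminf_le)
      show "norm (?w (Suc n)) \<le> (1 + A - b) / (1 + (A + real j) - b) * D n" for n
        using abs_well_poised_summand_Suc_le[of A b "A + real j" c n] A assms by (simp add: D_def del: pochhammer_Suc)
    qed (intro summable_mult \<open>summable D\<close>)
    moreover have "(\<Sum>n. (1 + A - b) / (1 + (A + real j) - b) * D n)
        = (1 + A - b) * suminf D * (1 / (1 + A - b + real j))"
      using \<open>summable D\<close> by (subst suminf_mult) (simp_all add: add_diff_eq diff_add_eq add_ac)
    ultimately show ?thesis by simp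
  qed
  have "(\<lambda>j. 1 / (1 + A - b + real j)) \<longlonglongrightarrow> 0"
    by real_asymp
  then have "(\<lambda>j. (1 + A - b) * suminf D * (1 / (1 + A - b + real j))) \<longlonglongrightarrow> 0"
    by (rule tendsto_mult_right_zero)
  then have "(\<lambda>j. suminf (well_poised_summand (A + real j) b c) - 1) \<longlonglongrightarrow> 0"
    by (rule Lim_null_comparison[OF always_eventually[OF allI[OF bound]]])
  then have "(\<lambda>j. suminf (well_poised_summand (a + real (j + J)) b c)) \<longlonglongrightarrow> 1"
    by (simp add: A_def LIM_zero_iff add_ac)
  then show ?thesis by (rule LIMSEQ_offset)
qed

section \<open>Closed form of the sum\<close>

text \<open>A classical limiting case of Dougall's 5F4 summation. Here j shifts of a turn the sum
  into a Pochhammer quotient times a factor tending to 1, and the quotient tends to the Gamma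
  expression.\<close>

theorem suminf_well_poised:
  assumes "a > 0" "1 + a - b > 0" "2 * (b + c) < a + 1" "c \<le> 1"
  shows "suminf (well_poised_summand a b c) =
    Gamma (1 + a - b) * Gamma (1 + a - c) / (Gamma (1 + a) * Gamma (1 + a - b - c))"
proof -
  have pos: "1 + a - c > 0" "1 + a > 0" using assms by auto
  let ?q = "\<lambda>j. pochhammer (1 + a) j * pochhammer (1 + a - b - c) j
      / (pochhammer (1 + a - b) j * pochhammer (1 + a - c) j)"
  let ?h = "\<lambda>z n. pochhammer z (Suc n) / (fact n * real n powr z)"
  have nz: "rGamma (1 + a - b) \<noteq> 0" "rGamma (1 + a - c) \<noteq> 0"
    using assms pos by (auto simp: rGamma_eq_zero_iff elim!: nonpos_Ints_cases)
  have "(\<lambda>n. ?h (1 + a) n * ?h (1 + a - b - c) n / (?h (1 + a - b) n * ?h (1 + a - c) n))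
      \<longlonglongrightarrow> rGamma (1 + a) * rGamma (1 + a - b - c) / (rGamma (1 + a - b) * rGamma (1 + a - c))"
    using nz by (intro tendsto_intros pochhammer_over_fact_powr_LIMSEQ) auto
  moreover have "eventually (\<lambda>n. ?h (1 + a) n * ?h (1 + a - b - c) n / (?h (1 + a - b) n * ?h (1 + a - c) n)
      = ?q (Suc n)) sequentially"
    using eventually_gt_at_top[of 0]
  proof eventually_elim
    case (elim n)
    \<comment> \<open>The parameters above and below have equal sums, so the powers of n introduced
      by the normalisation cancel.\<close>
    have "(1 + a) + (1 + a - b - c) = (1 + a - b) + (1 + a - c)" by simp
    then have "real n powr (1 + a) * real n powr (1 + a - b - c) = real n powr (1 + a - b) * real n powr (1 + a - c)"
      by (simp only: powr_add[symmetric])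
    then have e: "(fact n * real n powr (1 + a)) * (fact n * real n powr (1 + a - b - c))
       = (fact n * real n powr (1 + a - b)) * (fact n * real n powr (1 + a - c))"
      by (simp add: mult_ac)
    show ?case
      unfolding times_divide_times_eq e using elim by (simp del: pochhammer_Suc)
  qed
  ultimately have "(\<lambda>n. ?q (Suc n)) \<longlonglongrightarrow>
      rGamma (1 + a) * rGamma (1 + a - b - c) / (rGamma (1 + a - b) * rGamma (1 + a - c))"
    by (rule Lim_transform_eventually)
  then have "(\<lambda>n. ?q (Suc n) * suminf (well_poised_summand (a + real (Suc n)) b c)) \<longlonglongrightarrow>
      rGamma (1 + a) * rGamma (1 + a - b - c) / (rGamma (1 + a - b) * rGamma (1 + a - c)) * 1"
    by (intro tendsto_mult LIMSEQ_Suc[OF suminf_well_poised_tendsto_1] assms)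
  \<comment> \<open>By the iterated shift every member of the sequence equals the original sum, so
    the limit of this constant sequence is its value.\<close>
  then have "(\<lambda>n. suminf (well_poised_summand a b c)) \<longlonglongrightarrow>
      rGamma (1 + a) * rGamma (1 + a - b - c) / (rGamma (1 + a - b) * rGamma (1 + a - c)) * 1"
    by (simp only: suminf_well_poised_plus_nat[OF assms(1,2) pos(1) assms(3), symmetric])
  then show ?thesis
    by (simp add: LIMSEQ_const_iff rGamma_inverse_Gamma field_simps)
qed

section \<open>Specialisation to the series for 1/pi\<close>

text \<open>Reversing the sign of all n factors produces the \<open>(-1) ^ n\<close> of the
  alternating series.\<close>

lemma falling_factorial_eq_pochhammer:
  "falling_factorial x n = (-1) ^ n * pochhammer (- x) n"
  by (induction n) (simp_all add: falling_factorial_def pochhammer_Suc algebra_simps)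

lemma fact_add_eq_pochhammer:
  "fact (p + n) = (fact p * pochhammer (1 + real p) n :: real)"
  by (simp add: pochhammer_fact pochhammer_product')

text \<open>With b + c = 1 the Gamma denominator becomes a * Gamma(a)^2. Since a is a half-integer,
  Gamma(a) carries a factor sqrt(pi), and its square yields 1/pi.\<close>

theorem mainTheorem1:
  fixes m k :: nat
  assumes "k \<ge> 2"
  shows "summable (inv_pi_summand m k) \<and>
    1 / pi = pochhammer (1/2) (m + k) / 2 ^ (2 * m) * (fact (2 * m) / fact m)
               * (\<Sum>n. inv_pi_summand m k n)"
proof -
  define b where "b = real m + 1/2"
  define a where "a = real k + b"
  define c where "c = 1/2 - real m"
  have ab: "1 + a - b = 1 + real k" and ac: "1 + a - c = 1 + real (2 * m + k)"
    and abc: "1 + a - b - c = a" and pos: "a > 0" "b > 0" "c \<le> 1"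
    by (simp_all add: a_def b_def c_def)
  \<comment> \<open>\<open>C\<close> is the term of the series at n = 0, since the well-poised
    summand starts with 1.\<close>
  define C where "C = pochhammer b k * a / (fact k * fact (2 * m + k))"
  have summand: "inv_pi_summand m k = (\<lambda>n. C * well_poised_summand a b c n)"
  proof
    fix n
    have b_eq: "real m + 1/2 = b" by (simp add: b_def)
    have 1: "pochhammer b (k + n) = pochhammer b k * pochhammer a n"
      by (simp add: pochhammer_product' a_def add.commute)
    have 2: "falling_factorial (real m - 1/2) n = (-1) ^ n * pochhammer c n"
      by (simp add: falling_factorial_eq_pochhammer c_def)
    have 3: "real k + real m + 2 * real n + 1/2 = a + 2 * real n"
      by (simp add: a_def b_def)
    show "inv_pi_summand m k n = C * well_poised_summand a b c n"
      unfolding inv_pi_summand_def 1 2 3 well_poised_summand_def C_def ab ac b_eq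
        fact_add_eq_pochhammer[of k] fact_add_eq_pochhammer[of "2 * m + k"]
      using pos by (simp add: mult_ac)
  qed
  \<comment> \<open>As b + c = 1, this says a > 1, which k >= 2 guarantees.\<close>
  have conv: "2 * (b + c) < a + 1" using assms by (simp add: a_def b_def c_def)
  have "summable (well_poised_summand a b c)"
    using pos conv ab ac by (intro summable_well_poised) auto
  then have "summable (inv_pi_summand m k)"
    unfolding summand by (rule summable_mult)
  moreover have "1 / pi = pochhammer (1/2) (m + k) / 2 ^ (2 * m) * (fact (2 * m) / fact m)
               * (\<Sum>n. inv_pi_summand m k n)"
  proof -
    have split: "pochhammer (1/2) (m + k) = pochhammer (1/2) m * pochhammer b k"
      by (simp add: pochhammer_product' b_def add.commute[of "1/2"])
    have Gamma_a: "Gamma a = pochhammer (1/2) m * pochhammer b k * sqrt pi"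
    proof -
      have "pochhammer (1/2) (m + k) = Gamma (1/2 + real (m + k)) / Gamma (1/2 :: real)"
        by (intro pochhammer_Gamma) (auto elim!: nonpos_Ints_cases)
      moreover have "1/2 + real (m + k) = a" by (simp add: a_def b_def)
      ultimately show ?thesis
        by (simp add: Gamma_one_half_real split)
    qed
    have Gamma_a1: "Gamma (1 + a) = a * Gamma a"
    proof -
      have "a \<notin> \<int>\<^sub>\<le>\<^sub>0" using pos by (auto elim!: nonpos_Ints_cases)
      then show ?thesis using Gamma_plus1[of a] by (simp add: add.commute)
    qed
    have "(\<Sum>n. inv_pi_summand m k n) = C * suminf (well_poised_summand a b c)"
      unfolding summand by (rule suminf_mult) fact
    also have "suminf (well_poised_summand a b c) = fact k * fact (2 * m + k) / (a * Gamma a * Gamma a)"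
      using suminf_well_poised[of a b c] pos conv
      unfolding abc unfolding ab ac Gamma_fact Gamma_a1 by simp
    also have "C * \<dots> = pochhammer b k / (Gamma a * Gamma a)"
      using pos by (simp add: C_def)
    also have "\<dots> = 1 / (pi * pochhammer (1/2) m * (pochhammer (1/2) m * pochhammer b k))"
      unfolding Gamma_a using pochhammer_pos[of b k] pos by simp
    also note split[symmetric]
    \<comment> \<open>By \<open>fact_double\<close>, (2m)! / (4^m m!) equals
      \<open>pochhammer (1/2) m\<close>. The prefactor of the theorem therefore cancels everything
      in the denominator except pi.\<close>
    finally show ?thesis
      using pochhammer_pos[of "1/2::real" "m + k"] pochhammer_pos[of "1/2::real" m]
      by (simp add: fact_double)
  qed
  ultimately show ?thesis ..
qed

end
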